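(* As $\lambda\in\mathbb{C}$, $k\in\mathbb{N}_0$, and $x\in(-1,1)$, there are the mutually inverse sums $$\frac{C_k^{\lambda}\left(\frac1x\right)}{(1-x^2)^{\frac k2}x^{-k}}=\sum_{r=0}^{[k/2]}\frac{(\lambda)_{k-r}\,\mathcal{G}_{k-2r}\left(k+\lambda-\frac12,k+\lambda-\frac12,\sqrt{\frac{1-x}{1+x}}\right)}{(-2)^{r+k}(2\lambda+k)_{k-r}(1-x)^r}\,C_r^{k-r+\lambda}(x),$$ $$\frac{C_k^{k+\lambda}(x)}{(1-x)^k}=\sum_{r=0}^{2k}\frac{\mathcal{G}_{2k-r}\left(\frac12-2k-\lambda,\frac12-2k-\lambda,\sqrt{\frac{1-x}{1+x}}\right)}{(-2)^{r-k}\,\mathfrak{Y}_\lambda(k,r)\,(1-x^2)^{\frac r2}x^{-r}}\,C_r^{2k-r+\lambda}\!\left(\frac1x\right),$$ and $$\frac{C_k^{\lambda}(x)}{(1-x^2)^{\frac k2}}=\sum_{r=0}^{[k/2]}\frac{(\lambda)_{k-r}\,\widehat{\mathcal{G}}_{k-2r}\left(k+\lambda-\frac12,k+\lambda-\frac12,\sqrt{\frac{1-x}{1+x}}\right)}{(-2)^{k+r}(2\lambda+k)_{k-r}(1-x)^rx^{-r}}\,C_r^{k-r+\lambda}\!\left(\frac1x\right),$$ $$\frac{C_k^{k+\lambda}\left(\frac1x\right)}{(1-x)^kx^{-k}}=\sum_{r=0}^{2k}\frac{\widehat{\mathcal{G}}_{2k-r}\left(\frac12-2k-\lambda,\frac12-2k-\lambda,\sqrt{\frac{1-x}{1+x}}\right)}{(-2)^{r-k}\,\mathfrak{Y}_\lambda(k,r)\,(1-x^2)^{\frac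 r2}}\,C_r^{2k-r+\lambda}(x),$$ where $$\mathfrak{Y}_\lambda(k,r)=\frac{\Gamma(\lambda+k)\,\Gamma(2\lambda+4k-r)}{\Gamma(\lambda+2k-r)\,\Gamma(2\lambda+3k)}.$$
   Context: $\mathbb{N}_0=\{0,1,2,\dots\}$; $(a)_n=\Gamma(a+n)/\Gamma(a)=a(a+1)\cdots(a+n-1)$, $(a)_0=1$; $[\cdot]$ is the integer part. $C_k^{\lambda}(x)=\sum_{j=0}^{[k/2]}\frac{(-1)^j(\lambda)_{k-j}}{j!\,(k-2j)!}(2x)^{k-2j}$ is the Gegenbauer polynomial. The functions $\mathcal{G}_n(\tau,\rho,w)$ and $\widehat{\mathcal{G}}_n(\tau,\rho,\eta)$ are the Maclaurin coefficients $$(1-wz)^{\tau}\left(1+\frac zw\right)^{-\tau}(1+z^2)^{-\rho}=\sum_{n=0}^\infty\mathcal{G}_n(\tau,\rho,w)z^n,$$ $$(1+\eta\zeta)^{\tau}\left(1+\frac\zeta\eta\right)^{-\tau}(1-\zeta^2)^{-\rho}=\sum_{n=0}^\infty\widehat{\mathcal{G}}_n(\tau,\rho,\eta)\zeta^n,$$ for small $|z|,|\zeta|$, each factor being $1$ at $0$.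
   Formalization: In the first and third sums the factor (-2)^{r+k} is corrected to (-2)^{r-k} (as printed they fail already for k=1); x=0 is excluded since 1/x occurs; at λ where the right side is undefined (zero denominator or Gamma pole) equality is read as a limit in λ. *)

theory Defs
  imports "HOL-Complex_Analysis.Complex_Analysis"
begin

definition gegenbauer :: "nat \<Rightarrow> complex \<Rightarrow> complex \<Rightarrow> complex" where
  "gegenbauer k lam x =
     (\<Sum>j\<le>k div 2. (-1) ^ j * pochhammer lam (k - j) / (fact j * fact (k - 2 * j))
                      * (2 * x) ^ (k - 2 * j))"

(* Complex powr is the principal branch exp (t * Ln u), so every factor below is
   holomorphic near 0 and equal to 1 at 0. *)

definition gen_G :: "nat \<Rightarrow> complex \<Rightarrow> complex \<Rightarrow> complex \<Rightarrow> complex" where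
  "gen_G n \<tau> \<rho> w =
     fps_nth (fps_expansion
       (\<lambda>z. (1 - w * z) powr \<tau> * (1 + z / w) powr (- \<tau>) * (1 + z\<^sup>2) powr (- \<rho>)) 0) n"

definition gen_Ghat :: "nat \<Rightarrow> complex \<Rightarrow> complex \<Rightarrow> complex \<Rightarrow> complex" where
  "gen_Ghat n \<tau> \<rho> \<eta> =
     fps_nth (fps_expansion
       (\<lambda>\<zeta>. (1 + \<eta> * \<zeta>) powr \<tau> * (1 + \<zeta> / \<eta>) powr (- \<tau>) * (1 - \<zeta>\<^sup>2) powr (- \<rho>)) 0) n"

(* In HOL, Gamma is 0 at its poles; the value below is meaningful only if none of the four
   arguments is a non-positive integer.  For all r \<le> 2 * k together this amounts to
   lam \<notin> \<int>\<^sub>\<le>\<^sub>0 and 2 * lam + 2 * k \<notin> \<int>\<^sub>\<le>\<^sub>0 (the arguments for r = 2 * k), that is,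
   lam \<notin> sing_double k. *)
definition Upsilon :: "complex \<Rightarrow> nat \<Rightarrow> nat \<Rightarrow> complex" where
  "Upsilon lam k r =
     Gamma (lam + of_nat k) * Gamma (2 * lam + 4 * of_nat k - of_nat r) /
     (Gamma (lam + 2 * of_nat k - of_nat r) * Gamma (2 * lam + 3 * of_nat k))"

definition w_of :: "real \<Rightarrow> complex" where
  "w_of x = of_real (sqrt ((1 - x) / (1 + x)))"

(* The coefficients of the two expansions in each pair; g is gen_G or gen_Ghat.
   The power of -2 in coeff_half is r - k.  The exponent r + k found in print is a slip: it
   changes the sum by the factor 4 ^ (-k), so already for k = 1 the sum would be
   lam / (2 * sqrt (1 - x\<^sup>2)) instead of 2 * lam / sqrt (1 - x\<^sup>2). *)

definition coeff_half ::
  "(nat \<Rightarrow> complex \<Rightarrow> complex \<Rightarrow> complex \<Rightarrow> complex) \<Rightarrow> real \<Rightarrow> complex \<Rightarrow> nat \<Rightarrow> nat \<Rightarrow> complex" where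
  "coeff_half g x lam k r =
     pochhammer lam (k - r)
       * g (k - 2 * r) (of_nat k + lam - 1 / 2) (of_nat k + lam - 1 / 2) (w_of x) /
     ((- 2) powi (int r - int k) * pochhammer (2 * lam + of_nat k) (k - r))"

definition coeff_double ::
  "(nat \<Rightarrow> complex \<Rightarrow> complex \<Rightarrow> complex \<Rightarrow> complex) \<Rightarrow> real \<Rightarrow> complex \<Rightarrow> nat \<Rightarrow> nat \<Rightarrow> complex" where
  "coeff_double g x lam k r =
     g (2 * k - r) (1 / 2 - 2 * of_nat k - lam) (1 / 2 - 2 * of_nat k - lam) (w_of x) /
     ((- 2) powi (int r - int k) * Upsilon lam k r)"

(* An identity between expressions in the complex parameter lam.  Where R is undefined as
   written (lam \<in> S: a zero denominator or a Gamma pole) it is read as an identity of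
   meromorphic functions: the singularity of R is removable and L lam is the limit value. *)
definition identity_in_parameter ::
  "complex set \<Rightarrow> (complex \<Rightarrow> complex) \<Rightarrow> (complex \<Rightarrow> complex) \<Rightarrow> bool" where
  "identity_in_parameter S L R \<longleftrightarrow>
     (\<forall>lam. lam \<notin> S \<longrightarrow> L lam = R lam) \<and> (\<forall>lam. (R \<longlongrightarrow> L lam) (at lam))"

(* lam \<in> sing_half k iff some denominator (2 lam + k)_(k - r) with r \<le> k div 2 is zero;
   r = 0 has all the factors. *)
definition sing_half :: "nat \<Rightarrow> complex set" where
  "sing_half k = {lam. pochhammer (2 * lam + of_nat k) k = 0}"

definition sing_double :: "nat \<Rightarrow> complex set" where
  "sing_double k = {lam. lam \<in> \<int>\<^sub>\<le>\<^sub>0 \<or> 2 * lam + 2 * of_nat k \<in> \<int>\<^sub>\<le>\<^sub>0}"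

end

theory Submission
  imports Defs
begin

text \<open>
  Everything rests on one observation: when the degree $n$ and the parameter $\lambda$ of
  $C_n^\lambda(X)$ vary with $a = n + \lambda - \frac12$ fixed, the polynomials are, up to explicit
  Pochhammer factors, the Maclaurin coefficients of a single function,
  $$(2\lambda+n)_n \, c^n C_n^\lambda(X) = (-2)^n (\lambda)_n \, [z^n] \bigl((1 - Xcz)^2 - c^2z^2\bigr)^a$$
  (lemma \<open>gegenbauer_conv_quadratic_powr\<close>; it is Rodrigues' formula in disguise). In each of the sums,
  the parameters on both sides belong to the same $a$: here $k + \lambda - \frac12$ or
  $2k + \lambda - \frac12$.

  For the arguments $x$ and $1/x$ and suitable scalings $c$ the quadratics factor into linear terms.
  With $w = \sqrt{(1-x)/(1+x)}$, the argument $1/x$ gives $(1 - wz)(1 - z/w)$, while the argument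
  $x$, evaluated at $z^2$, gives
  $(1 - z^2/w^2)(1 + z^2) = (1 - z/w)(1 + z/w)(1 + z^2)$. The quotient of these, raised to the power
  $a$, is exactly the function that generates $\mathcal{G}_n(a,a,w)$. So the first sum is the
  Cauchy product $F_X(z) = G_a(z) F_Y(z^2)$, and the second one is
  $F_Y(z^2) = G_{-a}(z) F_X(z)$; they are inverse because $G_a G_{-a} = 1$. Exchanging $x$ with
  $1/x$ and changing the signs of $w$ and of $z^2$ gives the two sums with $\widehat{\mathcal{G}}_n$, so both
  pairs are instances of the locale \<open>gegenbauer_connection\<close>.

  The Pochhammer factors combine into $\mathfrak{Y}_\lambda$ (lemma \<open>Upsilon_shift\<close>). The parameters at
  which a coefficient is singular form a discrete set, and the left-hand sides are polynomials
  in $\lambda$, so the limits there follow from the identities nearby.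
\<close>

section \<open>Powers of a quadratic as power series\<close>

unbundle no vec_syntax

text \<open>
  For principal powers $(uv)^a = u^a v^a$ can fail; in the right half-plane the arguments of $u$ and
  $v$ add up to less than $\pi$ in absolute value, so the logarithms add. Every factor below is $1$
  at the origin and therefore falls under this case near it.
\<close>
lemma powr_mult_right_half_plane:
  fixes u v a :: complex
  assumes "Re u > 0" "Re v > 0"
  shows "(u * v) powr a = u powr a * v powr a"
proof -
  have "u \<noteq> 0" "v \<noteq> 0" using assms by auto
  moreover have "\<bar>Im (Ln u)\<bar> < pi / 2" "\<bar>Im (Ln v)\<bar> < pi / 2"
    using assms Re_Ln_pos_lt_imp by auto
  ultimately have "Ln (u * v) = Ln u + Ln v"
    by (intro Ln_times_simple) auto
  with \<open>u \<noteq> 0\<close> \<open>v \<noteq> 0\<close> show ?thesis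
    by (simp add: powr_def exp_add ring_distribs)
qed

definition linear_powr_fps :: "complex \<Rightarrow> complex \<Rightarrow> complex fps" where
  "linear_powr_fps a p = fps_binomial a oo (fps_const (- p) * fps_X)"

lemma linear_powr_fps_nth: "linear_powr_fps a p $ n = (a gchoose n) * (- p) ^ n"
  by (simp add: linear_powr_fps_def fps_compose_linear)

lemma linear_powr_fps_add: "linear_powr_fps a p * linear_powr_fps b p = linear_powr_fps (a + b) p"
  by (simp add: linear_powr_fps_def fps_binomial_add_mult fps_compose_mult_distrib)

lemma linear_powr_fps_power: "linear_powr_fps a p ^ n = linear_powr_fps (of_nat n * a) p"
proof (induction n)
  case 0
  show ?case by (simp add: linear_powr_fps_def)
qed (simp add: linear_powr_fps_add algebra_simps)

lemma has_fps_expansion_linear_powr: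
  "(\<lambda>z. (1 - p * z) powr a) has_fps_expansion linear_powr_fps a p"
proof -
  have "((\<lambda>u. (1 + u) powr a) \<circ> (\<lambda>z. (- p) * z)) has_fps_expansion linear_powr_fps a p"
    unfolding linear_powr_fps_def by (intro fps_expansion_intros) auto
  thus ?thesis by (simp add: o_def)
qed

text \<open>
  The coefficients of a product with a composition are a finite sum because $G^i$ has no terms of
  degree below $i$; here the factor $A$ is combined with each $G^i$ before coefficients are taken.
\<close>
lemma fps_mult_compose_nth:
  fixes A F G :: "complex fps"
  assumes "G $ 0 = 0"
  shows "(A * (F oo G)) $ n = (\<Sum>i\<le>n. F $ i * (A * G ^ i) $ n)"
proof -
  have "(F oo G) $ m = (\<Sum>i\<le>n. F $ i * G ^ i $ m)" if "m \<le> n" for m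
  proof -
    have "(\<Sum>i\<le>n. F $ i * G ^ i $ m) = (\<Sum>i=0..m. F $ i * G ^ i $ m)"
      using that startsby_zero_power_prefix[OF assms] by (intro sum.mono_neutral_right) auto
    thus ?thesis by (simp add: fps_compose_nth)
  qed
  hence "(A * (F oo G)) $ n = (\<Sum>j=0..n. A $ j * (\<Sum>i\<le>n. F $ i * G ^ i $ (n - j)))"
    by (simp add: fps_mult_nth)
  also have "\<dots> = (\<Sum>i\<le>n. F $ i * (A * G ^ i) $ n)"
    by (simp add: fps_mult_nth sum_distrib_left mult_ac, subst sum.swap, simp add: mult_ac)
  finally show ?thesis .
qed

definition quadratic_powr_fps :: "complex \<Rightarrow> complex \<Rightarrow> complex \<Rightarrow> complex fps" where
  "quadratic_powr_fps a p q = fps_expansion (\<lambda>z. ((1 - p * z)\<^sup>2 - q * z\<^sup>2) powr a) 0"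

lemma has_fps_expansion_quadratic_powr:
  "(\<lambda>z. ((1 - p * z)\<^sup>2 - q * z\<^sup>2) powr a) has_fps_expansion quadratic_powr_fps a p q"
  unfolding quadratic_powr_fps_def
  by (intro analytic_at_imp_has_fps_expansion_0 analytic_intros) auto

lemma eventually_Re_pos_near_0:
  fixes f :: "complex \<Rightarrow> complex"
  assumes "isCont f 0" "Re (f 0) > 0"
  shows "eventually (\<lambda>z. Re (f z) > 0) (nhds 0)"
proof -
  have "((\<lambda>z. Re (f z)) \<longlongrightarrow> Re (f 0)) (nhds 0)"
    using assms(1) by (intro tendsto_Re) (simp add: isCont_def tendsto_at_iff_tendsto_nhds)
  thus ?thesis using assms(2) by (rule order_tendstoD(1))
qed

text \<open>
  Pulling out the square gives $(1-pz)^2 - qz^2 = (1-pz)^2 \bigl(1 - qz^2(1-pz)^{-2}\bigr)$. Completing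
  the square in this way makes each coefficient a single sum whose terms are in bijection with those of
  the Gegenbauer polynomial, which would not be so for the product of the two linear factors.
\<close>
lemma quadratic_powr_fps_conv_compose:
  "quadratic_powr_fps a p q =
     linear_powr_fps (2 * a) p * (fps_binomial a oo (fps_const (- q) * fps_X ^ 2 * linear_powr_fps (- 2) p))"
proof (rule fps_expansion_unique_complex[OF has_fps_expansion_quadratic_powr])
  let ?g = "\<lambda>z. (- q) * z ^ 2 * (1 - p * z) powr (- 2)"
  let ?F = "linear_powr_fps (2 * a) p * (fps_binomial a oo (fps_const (- q) * fps_X ^ 2 * linear_powr_fps (- 2) p))"
  have "(\<lambda>z. (1 - p * z) powr (2 * a) * ((\<lambda>u. (1 + u) powr a) \<circ> ?g) z) has_fps_expansion ?F"
    by (intro fps_expansion_intros has_fps_expansion_linear_powr) auto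
  also have "?this \<longleftrightarrow> (\<lambda>z. ((1 - p * z)\<^sup>2 - q * z\<^sup>2) powr a) has_fps_expansion ?F"
  proof (rule has_fps_expansion_cong)
    have *: "eventually (\<lambda>z. Re (1 - p * z) > 0) (nhds 0)"
      by (rule eventually_Re_pos_near_0) (auto intro!: continuous_intros)
    have "eventually (\<lambda>z. Re (1 + ?g z) > 0) (nhds 0)"
      by (rule eventually_Re_pos_near_0) (auto intro!: continuous_intros)
    moreover have "eventually (\<lambda>z. Re ((1 - p * z)^2) > 0) (nhds 0)"
      by (rule eventually_Re_pos_near_0) (auto intro!: continuous_intros)
    ultimately show "\<forall>\<^sub>F z in nhds 0. (1 - p * z) powr (2 * a) * ((\<lambda>u. (1 + u) powr a) \<circ> ?g) z
        = ((1 - p * z)\<^sup>2 - q * z\<^sup>2) powr a"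
      using *
    proof eventually_elim
      case (elim z)
      have nz: "1 - p * z \<noteq> 0" using elim(3) by (metis less_irrefl zero_complex.simps(1))
      have "(1 - p * z) powr (- 2) = 1 / (1 - p * z)\<^sup>2"
        using nz by (simp add: powr_minus divide_inverse)
      hence "(1 - p * z)\<^sup>2 - q * z\<^sup>2 = (1 - p * z)\<^sup>2 * (1 + ?g z)"
        using nz by (simp add: ring_distribs)
      moreover have "(1 - p * z) powr (2 * a) = ((1 - p * z)\<^sup>2) powr a"
        unfolding power2_eq_square powr_mult_right_half_plane[OF elim(3) elim(3)] mult_2 powr_add ..
      ultimately show ?case
        by (simp only: o_def powr_mult_right_half_plane[OF elim(2) elim(1)])
    qed
  qed simp
  finally show "(\<lambda>z. ((1 - p * z)\<^sup>2 - q * z\<^sup>2) powr a) has_fps_expansion ?F" .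
qed

lemma quadratic_powr_fps_nth:
  "quadratic_powr_fps a p q $ n =
     (\<Sum>j\<le>n div 2. (a gchoose j) * (- q) ^ j * ((2 * a - 2 * of_nat j) gchoose (n - 2 * j)) * (- p) ^ (n - 2 * j))"
proof -
  let ?G = "fps_const (- q) * fps_X ^ 2 * linear_powr_fps (- 2) p"
  have pow: "linear_powr_fps (2 * a) p * ?G ^ i =
        fps_const ((- q) ^ i) * (fps_X ^ (2 * i) * linear_powr_fps (2 * a - 2 * of_nat i) p)" for i
  proof -
    have "(fps_X ^ 2 :: complex fps) ^ i = fps_X ^ (2 * i)"
      by (rule power_mult [symmetric])
    hence "linear_powr_fps (2 * a) p * ?G ^ i = fps_const ((- q) ^ i) * (fps_X ^ (2 * i) *
            (linear_powr_fps (2 * a) p * linear_powr_fps (- 2) p ^ i))"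
      by (simp add: power_mult_distrib fps_const_power mult_ac)
    thus ?thesis by (simp add: linear_powr_fps_power linear_powr_fps_add mult.commute)
  qed
  have "quadratic_powr_fps a p q $ n =
          (\<Sum>i\<le>n. (a gchoose i) * (linear_powr_fps (2 * a) p * ?G ^ i) $ n)"
    unfolding quadratic_powr_fps_conv_compose by (subst fps_mult_compose_nth) auto
  also have "\<dots> = (\<Sum>i\<le>n div 2. (a gchoose i) * (linear_powr_fps (2 * a) p * ?G ^ i) $ n)"
    unfolding pow by (intro sum.mono_neutral_right) (auto simp: fps_X_power_mult_nth)
  also have "\<dots> = (\<Sum>j\<le>n div 2. (a gchoose j) * (- q) ^ j * ((2 * a - 2 * of_nat j) gchoose (n - 2 * j)) * (- p) ^ (n - 2 * j))"
    unfolding pow by (intro sum.cong) (auto simp: fps_X_power_mult_nth linear_powr_fps_nth)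
  finally show ?thesis .
qed

section \<open>Gegenbauer polynomials as Maclaurin coefficients\<close>

text \<open>
  The comparison of one term each. It is the duplication formula
  $(2z)_{2j} = 4^j (z)_j (z+\frac12)_j$ with $z = \lambda + n - j$, applied to the last $2j$ factors of
  $(2\lambda+n)_n$; the remaining $n - 2j$ factors give the second binomial coefficient.
\<close>
lemma gegenbauer_term:
  fixes lam :: complex
  assumes "2 * j \<le> n"
  defines "a \<equiv> of_nat n + lam - 1 / 2"
  shows "pochhammer (2 * lam + of_nat n) n * (pochhammer lam (n - j) * 2 ^ (n - 2 * j) / (fact j * fact (n - 2 * j)))
     = 2 ^ n * pochhammer lam n * ((a gchoose j) * ((2 * a - 2 * of_nat j) gchoose (n - 2 * j)))"
proof -
  obtain m where n: "n = m + 2 * j" using assms(1) by (metis add.commute le_Suc_ex)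
  have 1: "pochhammer (2 * lam + of_nat n) n = pochhammer (2 * lam + of_nat n) m
      * (2 ^ (2 * j) * pochhammer (lam + of_nat (n - j)) j * pochhammer (lam + of_nat (n - j) + 1/2) j)"
    using pochhammer_product'[of "2 * lam + of_nat n" m "2 * j"] pochhammer_double[of "lam + of_nat (n - j)" j]
    by (simp add: n algebra_simps)
  have 2: "pochhammer lam n = pochhammer lam (n - j) * pochhammer (lam + of_nat (n - j)) j"
    using pochhammer_product[of "n - j" n lam] by (simp add: n)
  have 3: "a gchoose j = pochhammer (lam + of_nat (n - j) + 1/2) j / fact j"
    unfolding gbinomial_pochhammer' by (simp add: a_def n algebra_simps)
  have 4: "(2 * a - 2 * of_nat j) gchoose m = pochhammer (2 * lam + of_nat n) m / fact m"
    unfolding gbinomial_pochhammer' by (simp add: a_def n algebra_simps)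
  have m: "n - 2 * j = m" by (simp add: n)
  have p: "(2 :: complex) ^ n = 2 ^ m * 2 ^ (2 * j)" by (simp add: n power_add)
  show ?thesis unfolding 1 2 3 m 4 p by simp
qed

text \<open>
  The exponent on the right depends on $n$ and $\lambda$ only through $n + \lambda$. This is
  what puts $C_r^{k-r+\lambda}$, for all $r$, into one generating function.
\<close>
lemma gegenbauer_conv_quadratic_powr:
  fixes lam X c :: complex
  shows "pochhammer (2 * lam + of_nat n) n * (c ^ n * gegenbauer n lam X) =
     (- 2) ^ n * pochhammer lam n * quadratic_powr_fps (of_nat n + lam - 1 / 2) (X * c) (c ^ 2) $ n"
proof -
  let ?a = "of_nat n + lam - 1 / 2"
  have "pochhammer (2 * lam + of_nat n) n * (c ^ n * gegenbauer n lam X) =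
     (\<Sum>j\<le>n div 2. (pochhammer (2 * lam + of_nat n) n * (pochhammer lam (n - j) * 2 ^ (n - 2 * j) / (fact j * fact (n - 2 * j))))
         * ((- 1) ^ j * c ^ n * X ^ (n - 2 * j)))"
    unfolding gegenbauer_def sum_distrib_left
    by (intro sum.cong) (auto simp: power_mult_distrib)
  also have "\<dots> = (\<Sum>j\<le>n div 2. (2 ^ n * pochhammer lam n * ((?a gchoose j) * ((2 * ?a - 2 * of_nat j) gchoose (n - 2 * j))))
         * ((- 1) ^ j * c ^ n * X ^ (n - 2 * j)))"
    by (intro sum.cong refl arg_cong2[where f = "(*)"] gegenbauer_term) auto
  also have "\<dots> = (- 2) ^ n * pochhammer lam n * quadratic_powr_fps ?a (X * c) (c ^ 2) $ n"
    unfolding quadratic_powr_fps_nth sum_distrib_left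
  proof (intro sum.cong refl)
    fix j assume "j \<in> {..n div 2}"
    then have "2 * j \<le> n" by auto
    then obtain m where n: "n = m + 2 * j" by (metis add.commute le_Suc_ex)
    \<comment> \<open>\<open>n\<close> and \<open>m = n - 2 * j\<close> have the same parity, so the signs of \<open>- 2\<close> and \<open>- (X * c)\<close> cancel\<close>
    have "(- 1 :: complex) ^ n * (- 1) ^ m = 1"
      unfolding power_add[symmetric] using n by (intro neg_one_even_power) simp
    hence sign: "(- 2 :: complex) ^ n * (- (X * c)) ^ m = 2 ^ n * (X * c) ^ m"
      unfolding power_minus[of 2] power_minus[of "X * c"] by simp
    have sq: "(- (c\<^sup>2)) ^ j = (- 1) ^ j * c ^ (2 * j)"
      unfolding power_minus[of "c\<^sup>2"] power_mult ..
    have "(- 2) ^ n * pochhammer lam n * ((?a gchoose j) * (- (c\<^sup>2)) ^ j * ((2 * ?a - 2 * of_nat j) gchoose (n - 2 * j)) * (- (X * c)) ^ (n - 2 * j))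
        = ((- 2) ^ n * (- (X * c)) ^ m) * (pochhammer lam n * ((?a gchoose j) * (- (c\<^sup>2)) ^ j * ((2 * ?a - 2 * of_nat j) gchoose m)))"
      by (simp add: n)
    also have "\<dots> = (2 ^ n * (X * c) ^ m) * (pochhammer lam n * ((?a gchoose j) * (- (c\<^sup>2)) ^ j * ((2 * ?a - 2 * of_nat j) gchoose m)))"
      unfolding sign ..
    also have "\<dots> = (2 ^ n * pochhammer lam n * ((?a gchoose j) * ((2 * ?a - 2 * of_nat j) gchoose (n - 2 * j))))
         * ((- 1) ^ j * c ^ n * X ^ (n - 2 * j))"
      unfolding sq by (simp add: n power_add power_mult_distrib)
    finally show "(2 ^ n * pochhammer lam n * ((?a gchoose j) * ((2 * ?a - 2 * of_nat j) gchoose (n - 2 * j))))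
         * ((- 1) ^ j * c ^ n * X ^ (n - 2 * j)) =
        (- 2) ^ n * pochhammer lam n * ((?a gchoose j) * (- (c\<^sup>2)) ^ j * ((2 * ?a - 2 * of_nat j) gchoose (n - 2 * j)) * (- (X * c)) ^ (n - 2 * j))" ..
  qed
  finally show ?thesis .
qed

lemma fps_mult_compose_X_square_nth:
  fixes A F :: "complex fps"
  shows "(A * (F oo fps_X ^ 2)) $ n = (\<Sum>r\<le>n div 2. A $ (n - 2 * r) * F $ r)"
proof -
  have "(A * (F oo fps_X ^ 2)) $ n = (\<Sum>r\<le>n. F $ r * (A * fps_X ^ (2 * r)) $ n)"
    by (subst fps_mult_compose_nth) (simp_all flip: power_mult)
  also have "\<dots> = (\<Sum>r\<le>n div 2. F $ r * (A * fps_X ^ (2 * r)) $ n)"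
    by (intro sum.mono_neutral_right) (auto simp: fps_X_power_mult_right_nth)
  also have "\<dots> = (\<Sum>r\<le>n div 2. A $ (n - 2 * r) * F $ r)"
    by (intro sum.cong) (auto simp: fps_X_power_mult_right_nth)
  finally show ?thesis .
qed

section \<open>The factor $\mathfrak{Y}_\lambda$\<close>

text \<open>
  All Gamma arguments arise from $\lambda$ or $2\lambda+2k$ by adding natural numbers, and the
  complement of the non-positive integers is closed under this.
\<close>
lemma Upsilon_args_regular:
  fixes lam :: complex
  assumes "lam \<notin> sing_double k" "r \<le> 2 * k"
  shows "lam + of_nat k \<notin> \<int>\<^sub>\<le>\<^sub>0" "lam + of_nat (2 * k - r) \<notin> \<int>\<^sub>\<le>\<^sub>0"
    and "2 * lam + of_nat (3 * k) \<notin> \<int>\<^sub>\<le>\<^sub>0" "2 * lam + of_nat (4 * k - r) \<notin> \<int>\<^sub>\<le>\<^sub>0"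
proof -
  have shift: "z + of_nat n \<notin> \<int>\<^sub>\<le>\<^sub>0" if "z \<notin> \<int>\<^sub>\<le>\<^sub>0" for z :: complex and n
    using that nonpos_Ints_diff_Nats[of "z + of_nat n" "of_nat n"] by auto
  have lam: "lam \<notin> \<int>\<^sub>\<le>\<^sub>0" and lam2: "2 * lam + of_nat (2 * k) \<notin> \<int>\<^sub>\<le>\<^sub>0"
    using assms(1) by (auto simp: sing_double_def)
  from lam show "lam + of_nat k \<notin> \<int>\<^sub>\<le>\<^sub>0" "lam + of_nat (2 * k - r) \<notin> \<int>\<^sub>\<le>\<^sub>0"
    by (rule shift)+
  have "of_nat (3 * k) = of_nat (2 * k) + (of_nat k :: complex)"
    and "of_nat (4 * k - r) = of_nat (2 * k) + (of_nat (2 * k - r) :: complex)"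
    using assms(2) by (simp_all flip: of_nat_add)
  thus "2 * lam + of_nat (3 * k) \<notin> \<int>\<^sub>\<le>\<^sub>0" "2 * lam + of_nat (4 * k - r) \<notin> \<int>\<^sub>\<le>\<^sub>0"
    using shift[OF lam2] by (metis add.assoc)+
qed

lemma Upsilon_of_nat:
  assumes "r \<le> 2 * k"
  shows "Upsilon lam k r = Gamma (lam + of_nat k) * Gamma (2 * lam + of_nat (4 * k - r)) /
     (Gamma (lam + of_nat (2 * k - r)) * Gamma (2 * lam + of_nat (3 * k)))"
  using assms by (simp add: Upsilon_def of_nat_diff add_diff_eq)

lemma Upsilon_nonzero:
  assumes "lam \<notin> sing_double k" "r \<le> 2 * k"
  shows "Upsilon lam k r \<noteq> 0"
  using Upsilon_args_regular[OF assms] by (simp add: Upsilon_of_nat[OF assms(2)] Gamma_eq_zero_iff)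

lemma Upsilon_diagonal:
  assumes "lam \<notin> sing_double k"
  shows "Upsilon lam k k = 1"
proof -
  have "2 * k - k = k" "4 * k - k = 3 * k" by auto
  thus ?thesis using Upsilon_args_regular[OF assms, of k]
    by (simp add: Upsilon_of_nat Gamma_eq_zero_iff del: of_nat_mult)
qed

lemma pochhammer_nonzero_of_regular:
  fixes z :: complex
  assumes "z \<notin> \<int>\<^sub>\<le>\<^sub>0"
  shows "pochhammer z n \<noteq> 0"
  using assms by (auto simp: pochhammer_eq_0_iff)

text \<open>
  The Pochhammer quotient that a term of index $r$ contributes turns $\mathfrak{Y}_\lambda(k,r)$ into
  $\mathfrak{Y}_\lambda(k,s)$, which no longer depends on $r$. With $s = 0$ this evaluates the
  coefficients of the sums up to $2k$; with general $s$ it takes the Pochhammer symbols out of the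
  product of the two coefficient matrices.
\<close>
lemma Upsilon_shift:
  assumes "lam \<notin> sing_double k" "s \<le> r" "r \<le> 2 * k"
  shows "Upsilon lam k s * pochhammer (lam + of_nat (2 * k - r)) (r - s) =
         pochhammer (2 * lam + of_nat (4 * k - r)) (r - s) * Upsilon lam k r"
proof -
  have s: "s \<le> 2 * k" using assms by simp
  note reg = Upsilon_args_regular[OF assms(1,3)] Upsilon_args_regular[OF assms(1) s]
  have e: "2 * k - r + (r - s) = 2 * k - s" "4 * k - r + (r - s) = 4 * k - s"
    using assms by auto
  have 1: "pochhammer (lam + of_nat (2 * k - r)) (r - s) =
      Gamma (lam + of_nat (2 * k - s)) / Gamma (lam + of_nat (2 * k - r))"
    using pochhammer_Gamma[OF reg(2), of "r - s"] e by (simp add: add.assoc flip: of_nat_add)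
  have 2: "pochhammer (2 * lam + of_nat (4 * k - r)) (r - s) =
      Gamma (2 * lam + of_nat (4 * k - s)) / Gamma (2 * lam + of_nat (4 * k - r))"
    using pochhammer_Gamma[OF reg(4), of "r - s"] e by (simp add: add.assoc flip: of_nat_add)
  show ?thesis
    unfolding 1 2 Upsilon_of_nat[OF assms(3)] Upsilon_of_nat[OF s]
    using reg[unfolded Gamma_eq_zero_iff[symmetric]] by (simp add: field_simps)
qed

section \<open>A pair of mutually inverse sums\<close>

text \<open>
  What both pairs of sums have in common. The polynomials at $X$, scaled by $c$, are expanded
  in the sums up to $[k/2]$ and belong to the quadratic $(1-\alpha z)(1-\beta z)$; those at $Y$,
  scaled by $d$, belong to one that, at $z^2$, has the factors $1 - \beta z$, $1 + \beta z$ and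
  $1 + \epsilon z^2$. The common factor $1 - \beta z$ cancels in the quotient, which leaves the
  function that generates \<open>g\<close>.
\<close>
locale gegenbauer_connection =
  fixes g :: "nat \<Rightarrow> complex \<Rightarrow> complex \<Rightarrow> complex \<Rightarrow> complex" and x :: real
    and X c Y d \<alpha> \<beta> \<epsilon> :: complex
  assumes g_eq: "g n b b (w_of x) =
      fps_expansion (\<lambda>z. (1 - \<alpha> * z) powr b * (1 + \<beta> * z) powr (- b) * (1 + \<epsilon> * z\<^sup>2) powr (- b)) 0 $ n"
    and factor_X: "(1 - X * c * z)\<^sup>2 - c\<^sup>2 * z\<^sup>2 = (1 - \<alpha> * z) * (1 - \<beta> * z)"
    and factor_Y: "(1 - Y * d * z)\<^sup>2 - d\<^sup>2 * z\<^sup>2 = (1 - \<beta>\<^sup>2 * z) * (1 + \<epsilon> * z)"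
begin

definition G :: "complex \<Rightarrow> complex fps" where
  "G b = Abs_fps (\<lambda>n. g n b b (w_of x))"

abbreviation FX :: "complex \<Rightarrow> complex fps" where
  "FX b \<equiv> quadratic_powr_fps b (X * c) (c\<^sup>2)"

abbreviation FY :: "complex \<Rightarrow> complex fps" where
  "FY b \<equiv> quadratic_powr_fps b (Y * d) (d\<^sup>2)"

lemma has_fps_expansion_G:
  "(\<lambda>z. (1 - \<alpha> * z) powr b * (1 + \<beta> * z) powr (- b) * (1 + \<epsilon> * z\<^sup>2) powr (- b)) has_fps_expansion G b"
proof -
  have "G b = fps_expansion (\<lambda>z. (1 - \<alpha> * z) powr b * (1 + \<beta> * z) powr (- b) * (1 + \<epsilon> * z\<^sup>2) powr (- b)) 0"
    by (simp add: G_def g_eq fps_eq_iff)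
  thus ?thesis
    by (auto intro!: analytic_at_imp_has_fps_expansion_0 analytic_intros)
qed

lemma eventually_factors_right_half_plane:
  "\<forall>\<^sub>F z in nhds 0. Re (1 - \<alpha> * z) > 0 \<and> Re (1 + \<beta> * z) > 0 \<and> Re (1 - \<beta> * z) > 0 \<and>
      Re (1 + \<epsilon> * z\<^sup>2) > 0 \<and> Re ((1 - \<beta> * z) * (1 + \<beta> * z)) > 0"
  by (intro eventually_conj eventually_Re_pos_near_0) (auto intro!: continuous_intros)

lemma G_mult_G_minus: "G b * G (- b) = 1"
proof (rule fps_expansion_unique_complex)
  show "(\<lambda>z. ((1 - \<alpha> * z) powr b * (1 + \<beta> * z) powr (- b) * (1 + \<epsilon> * z\<^sup>2) powr (- b)) *
          ((1 - \<alpha> * z) powr (- b) * (1 + \<beta> * z) powr (- (- b)) * (1 + \<epsilon> * z\<^sup>2) powr (- (- b))))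
        has_fps_expansion G b * G (- b)" (is "?f has_fps_expansion _")
    by (intro has_fps_expansion_mult has_fps_expansion_G)
  have "\<forall>\<^sub>F z in nhds 0. 1 = ?f z"
    using eventually_factors_right_half_plane
  proof eventually_elim
    case (elim z)
    hence "1 - \<alpha> * z \<noteq> 0" "1 + \<beta> * z \<noteq> 0" "1 + \<epsilon> * z\<^sup>2 \<noteq> 0"
      by (metis less_irrefl zero_complex.simps(1))+
    thus ?case by (simp add: powr_minus field_simps)
  qed
  hence "(\<lambda>_. 1) has_fps_expansion (1 :: complex fps) \<longleftrightarrow> ?f has_fps_expansion 1"
    by (rule has_fps_expansion_cong) simp
  thus "?f has_fps_expansion 1" by simp
qed

lemma G_mult_FY: "G b * (FY b oo fps_X ^ 2) = FX b"
proof (rule fps_expansion_unique_complex[OF _ has_fps_expansion_quadratic_powr])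
  let ?f = "\<lambda>z. (1 - \<alpha> * z) powr b * (1 + \<beta> * z) powr (- b) * (1 + \<epsilon> * z\<^sup>2) powr (- b)"
  let ?h = "\<lambda>t. ((1 - Y * d * t)\<^sup>2 - d\<^sup>2 * t\<^sup>2) powr b"
  have "(\<lambda>z. ?f z * (?h \<circ> (\<lambda>z. z\<^sup>2)) z) has_fps_expansion G b * (FY b oo fps_X ^ 2)"
    by (intro has_fps_expansion_mult has_fps_expansion_G has_fps_expansion_compose
              has_fps_expansion_quadratic_powr fps_expansion_intros) auto
  also have "?this \<longleftrightarrow> (\<lambda>z. ((1 - X * c * z)\<^sup>2 - c\<^sup>2 * z\<^sup>2) powr b) has_fps_expansion G b * (FY b oo fps_X ^ 2)"
  proof (rule has_fps_expansion_cong)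
    show "\<forall>\<^sub>F z in nhds 0. ?f z * (?h \<circ> (\<lambda>z. z\<^sup>2)) z = ((1 - X * c * z)\<^sup>2 - c\<^sup>2 * z\<^sup>2) powr b"
      using eventually_factors_right_half_plane
    proof eventually_elim
      case (elim z)
      hence nz: "1 + \<beta> * z \<noteq> 0" "1 + \<epsilon> * z\<^sup>2 \<noteq> 0"
        by (metis less_irrefl zero_complex.simps(1))+
      have "1 - \<beta>\<^sup>2 * z\<^sup>2 = (1 - \<beta> * z) * (1 + \<beta> * z)"
        by (simp add: algebra_simps power2_eq_square)
      hence "?h (z\<^sup>2) = (1 - \<beta> * z) powr b * (1 + \<beta> * z) powr b * (1 + \<epsilon> * z\<^sup>2) powr b"
        unfolding factor_Y using elim by (simp add: powr_mult_right_half_plane)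
      moreover have "((1 - X * c * z)\<^sup>2 - c\<^sup>2 * z\<^sup>2) powr b = (1 - \<alpha> * z) powr b * (1 - \<beta> * z) powr b"
        unfolding factor_X using elim by (intro powr_mult_right_half_plane) auto
      ultimately show ?case
        using nz by (simp add: powr_minus field_simps)
    qed
  qed simp
  finally show "(\<lambda>z. ((1 - X * c * z)\<^sup>2 - c\<^sup>2 * z\<^sup>2) powr b) has_fps_expansion G b * (FY b oo fps_X ^ 2)" .
qed

lemma FX_nth: "FX b $ n = (\<Sum>r\<le>n div 2. G b $ (n - 2 * r) * FY b $ r)"
  by (simp add: fps_mult_compose_X_square_nth flip: G_mult_FY)

lemma FY_nth: "FY b $ n = (\<Sum>r\<le>2 * n. G (- b) $ (2 * n - r) * FX b $ r)"
proof -
  \<comment> \<open>the composition with \<open>z\<^sup>2\<close> is what doubles the length of the sum\<close>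
  have "FY b $ n = (FY b oo fps_X ^ 2) $ (2 * n)"
    by (simp add: fps_nth_compose_X_power)
  also have "FY b oo fps_X ^ 2 = FX b * G (- b)"
    unfolding G_mult_FY[symmetric] using G_mult_G_minus[of b] by (simp add: mult_ac)
  also have "(FX b * G (- b)) $ (2 * n) = (\<Sum>r\<le>2 * n. FX b $ r * G (- b) $ (2 * n - r))"
    by (simp add: fps_mult_nth atLeast0AtMost)
  also have "\<dots> = (\<Sum>r\<le>2 * n. G (- b) $ (2 * n - r) * FX b $ r)"
    by (simp only: mult.commute)
  finally show ?thesis .
qed

text \<open>
  This is \<open>FX_nth\<close> after \<open>gegenbauer_conv_quadratic_powr\<close>: the normalising factors of degree $k$ split
  as $(\lambda)_k = (\lambda)_{k-r}(\lambda+k-r)_r$ and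
  $(2\lambda+k)_k = (2\lambda+k)_{k-r}(2\lambda+2k-r)_r$, whose last parts normalise
  $C_r^{k-r+\lambda}(Y)$.
\<close>
theorem half_expansion:
  assumes "lam \<notin> sing_half k"
  shows "c ^ k * gegenbauer k lam X =
     (\<Sum>r\<le>k div 2. coeff_half g x lam k r * (d ^ r * gegenbauer r (of_nat k - of_nat r + lam) Y))"
proof -
  define b where "b = of_nat k + lam - 1 / 2"
  have nz: "pochhammer (2 * lam + of_nat k) k \<noteq> 0"
    using assms by (simp add: sing_half_def)
  have "pochhammer (2 * lam + of_nat k) k * (c ^ k * gegenbauer k lam X) =
          (- 2) ^ k * pochhammer lam k * FX b $ k"
    unfolding b_def by (rule gegenbauer_conv_quadratic_powr)
  also have "\<dots> = (\<Sum>r\<le>k div 2. (- 2) ^ k * pochhammer lam k * (G b $ (k - 2 * r) * FY b $ r))"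
    by (simp add: FX_nth sum_distrib_left)
  also have "\<dots> = (\<Sum>r\<le>k div 2. pochhammer (2 * lam + of_nat k) k *
      (coeff_half g x lam k r * (d ^ r * gegenbauer r (of_nat k - of_nat r + lam) Y)))"
  proof (intro sum.cong refl)
    fix r assume "r \<in> {..k div 2}"
    hence "r \<le> k" by auto
    then obtain m where k: "k = m + r" by (metis add.commute le_Suc_ex)
    define C where "C = d ^ r * gegenbauer r (of_nat m + lam) Y"
    have "(of_nat k - of_nat r + lam :: complex) = of_nat m + lam" by (simp add: k)
    have p1: "pochhammer (2 * lam + of_nat k) k =
        pochhammer (2 * lam + of_nat k) m * pochhammer (2 * (of_nat m + lam) + of_nat r) r"
      using pochhammer_product'[of "2 * lam + of_nat k" m r] by (simp add: k algebra_simps)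
    have p2: "pochhammer lam k = pochhammer lam m * pochhammer (of_nat m + lam) r"
      using pochhammer_product'[of lam m r] by (simp add: k algebra_simps)
    have C: "pochhammer (2 * (of_nat m + lam) + of_nat r) r * C =
        (- 2) ^ r * pochhammer (of_nat m + lam) r * FY b $ r"
      using gegenbauer_conv_quadratic_powr[of "of_nat m + lam" r d Y]
      by (simp add: C_def b_def k add_ac)
    have e: "k - r = m" "int r - int k = - int m"
      by (simp_all add: k)
    have cf: "coeff_half g x lam k r = pochhammer lam m * G b $ (k - 2 * r) * (- 2) ^ m / pochhammer (2 * lam + of_nat k) m"
      unfolding coeff_half_def e b_def[symmetric] by (simp add: G_def power_int_minus field_simps)
    have nz': "pochhammer (2 * lam + of_nat k) m \<noteq> 0" using nz unfolding p1 by auto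
    have "pochhammer (2 * lam + of_nat k) k * (coeff_half g x lam k r * C) =
       pochhammer lam m * G b $ (k - 2 * r) * (- 2) ^ m * (pochhammer (2 * (of_nat m + lam) + of_nat r) r * C)"
      unfolding p1 cf using nz' by (simp add: mult_ac)
    also have "\<dots> = (- 2) ^ k * pochhammer lam k * (G b $ (k - 2 * r) * FY b $ r)"
      unfolding C p2 power_add[of _ m r, folded k] by (simp only: mult_ac)
    finally show "(- 2) ^ k * pochhammer lam k * (G b $ (k - 2 * r) * FY b $ r) =
      pochhammer (2 * lam + of_nat k) k * (coeff_half g x lam k r * (d ^ r * gegenbauer r (of_nat k - of_nat r + lam) Y))"
      by (simp add: C_def k)
  qed
  finally show ?thesis
    using nz by (simp flip: sum_distrib_left)
qed

lemma coeff_double_eq: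
  "coeff_double g x lam k r =
     G (- (2 * of_nat k + lam - 1 / 2)) $ (2 * k - r) / ((- 2) powi (int r - int k) * Upsilon lam k r)"
proof -
  have "1 / 2 - 2 * of_nat k - lam = - (2 * of_nat k + lam - 1 / 2)" by simp
  thus ?thesis unfolding coeff_double_def G_def by (simp only: fps_nth_Abs_fps)
qed

text \<open>
  This is \<open>FY_nth\<close>. Its terms have the normalising factors
  $(2\lambda+4k-r)_r / (2k-r+\lambda)_r = \mathfrak{Y}_\lambda(k,0) / \mathfrak{Y}_\lambda(k,r)$, so that after
  multiplication by $\mathfrak{Y}_\lambda(k,0)$ both sides are free of Pochhammer symbols. The left-hand
  side is the case $r = k$, where $\mathfrak{Y}_\lambda(k,k) = 1$.
\<close>
theorem double_expansion:
  assumes "lam \<notin> sing_double k"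
  shows "d ^ k * gegenbauer k (of_nat k + lam) Y =
     (\<Sum>r\<le>2 * k. coeff_double g x lam k r * (c ^ r * gegenbauer r (2 * of_nat k - of_nat r + lam) X))"
proof -
  define b where "b = 2 * of_nat k + lam - 1 / 2"
  let ?Y = "Upsilon lam k"
  \<comment> \<open>for \<open>r = k\<close> this is applied to \<open>d\<close> and \<open>Y\<close>, for every \<open>r\<close> to \<open>c\<close> and \<open>X\<close>\<close>
  have geg: "?Y 0 * (e ^ r * gegenbauer r (lam + of_nat (2 * k - r)) Z) =
       (- 2) ^ r * ?Y r * quadratic_powr_fps b (Z * e) (e\<^sup>2) $ r" if "r \<le> 2 * k" for r Z e
  proof -
    let ?mu = "lam + of_nat (2 * k - r)"
    let ?C = "e ^ r * gegenbauer r ?mu Z" and ?F = "quadratic_powr_fps b (Z * e) (e\<^sup>2) $ r"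
    have eqs: "2 * ?mu + of_nat r = 2 * lam + of_nat (4 * k - r)" "of_nat r + ?mu - 1 / 2 = b"
      using that by (simp_all add: b_def of_nat_diff)
    have nz: "pochhammer (2 * lam + of_nat (4 * k - r)) r \<noteq> 0"
      using Upsilon_args_regular[OF assms that] by (intro pochhammer_nonzero_of_regular)
    have conv: "pochhammer (2 * lam + of_nat (4 * k - r)) r * ?C = (- 2) ^ r * pochhammer ?mu r * ?F"
      using gegenbauer_conv_quadratic_powr[of ?mu r e Z] unfolding eqs .
    have shift: "?Y 0 * pochhammer ?mu r = pochhammer (2 * lam + of_nat (4 * k - r)) r * ?Y r"
      using Upsilon_shift[OF assms _ that, of 0] by simp
    have "pochhammer (2 * lam + of_nat (4 * k - r)) r * (?Y 0 * ?C) =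
        (?Y 0 * pochhammer ?mu r) * ((- 2) ^ r * ?F)"
      unfolding mult.left_commute[of _ "?Y 0"] conv by (simp only: mult_ac)
    also have "\<dots> = pochhammer (2 * lam + of_nat (4 * k - r)) r * ((- 2) ^ r * ?Y r * ?F)"
      unfolding shift by (simp only: mult_ac)
    finally show ?thesis using nz by (metis mult_left_cancel)
  qed
  have "?Y 0 * (d ^ k * gegenbauer k (of_nat k + lam) Y) = (- 2) ^ k * FY b $ k"
    using geg[of k d Y] Upsilon_diagonal[OF assms] by (simp add: add.commute)
  also have "\<dots> = (\<Sum>r\<le>2 * k. (- 2) ^ k * (G (- b) $ (2 * k - r) * FX b $ r))"
    by (simp add: FY_nth sum_distrib_left)
  also have "\<dots> = (\<Sum>r\<le>2 * k. ?Y 0 * (coeff_double g x lam k r *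
                     (c ^ r * gegenbauer r (2 * of_nat k - of_nat r + lam) X)))"
  proof (intro sum.cong refl)
    fix r assume "r \<in> {..2 * k}"
    hence r: "r \<le> 2 * k" by simp
    have nz: "?Y r \<noteq> 0" by (rule Upsilon_nonzero[OF assms r])
    have "?Y 0 * (coeff_double g x lam k r * (c ^ r * gegenbauer r (2 * of_nat k - of_nat r + lam) X)) =
       coeff_double g x lam k r * (?Y 0 * (c ^ r * gegenbauer r (lam + of_nat (2 * k - r)) X))"
      using r by (simp add: of_nat_diff add_ac)
    also have "\<dots> = coeff_double g x lam k r * ((- 2) ^ r * ?Y r * FX b $ r)"
      by (simp only: geg[OF r])
    also have "\<dots> = (- 2) ^ k * (G (- b) $ (2 * k - r) * FX b $ r)"
      using nz by (simp add: coeff_double_eq b_def power_int_diff field_simps)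
    finally show "(- 2) ^ k * (G (- b) $ (2 * k - r) * FX b $ r) = ?Y 0 * (coeff_double g x lam k r *
                     (c ^ r * gegenbauer r (2 * of_nat k - of_nat r + lam) X))" ..
  qed
  finally show ?thesis
    using Upsilon_nonzero[OF assms, of 0] by (simp flip: sum_distrib_left)
qed

text \<open>
  In \<open>coeff_half\<close> the degree $r$ and the parameter $\lambda + 2k - r$ again give
  $2k + \lambda - \frac12$. Hence the sum over $r$ is the coefficient of $z^{2k-2s}$ in
  $G_{-b} G_b = 1$, up to a factor that does not depend on $r$ and is $1$ for $s = k$.
\<close>
theorem coeff_double_coeff_half_inverse:
  assumes "lam \<notin> sing_double k" "s \<le> k"
  shows "(\<Sum>r = 2 * s..2 * k. coeff_double g x lam k r * coeff_half g x (lam + 2 * of_nat k - of_nat r) r s)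
           = (if s = k then 1 else 0)"
proof -
  define b where "b = 2 * of_nat k + lam - 1 / 2"
  have "(\<Sum>r = 2 * s..2 * k. coeff_double g x lam k r * coeff_half g x (lam + 2 * of_nat k - of_nat r) r s) =
        (\<Sum>r = 2 * s..2 * k. (- 2) powi (int k - int s) / Upsilon lam k s * (G (- b) $ (2 * k - r) * G b $ (r - 2 * s)))"
  proof (intro sum.cong refl)
    fix r assume "r \<in> {2 * s..2 * k}"
    hence r: "2 * s \<le> r" "s \<le> r" "r \<le> 2 * k" by auto
    let ?p = "pochhammer (lam + of_nat (2 * k - r)) (r - s)"
    let ?q = "pochhammer (2 * lam + of_nat (4 * k - r)) (r - s)"
    let ?mu = "lam + 2 * of_nat k - of_nat r"
    have mu: "?mu = lam + of_nat (2 * k - r)" "2 * ?mu + of_nat r = 2 * lam + of_nat (4 * k - r)"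
        "of_nat r + ?mu - 1 / 2 = b"
      using r by (simp_all add: b_def of_nat_diff)
    have half: "coeff_half g x ?mu r s = ?p * G b $ (r - 2 * s) / ((- 2) powi (int s - int r) * ?q)"
      unfolding coeff_half_def mu(2,3) unfolding mu(1) by (simp add: G_def)
    have nz: "Upsilon lam k r \<noteq> 0" "Upsilon lam k s \<noteq> 0" "?q \<noteq> 0"
      using Upsilon_nonzero[OF assms(1)] Upsilon_args_regular[OF assms(1) r(3)] r
      by (auto intro!: pochhammer_nonzero_of_regular)
    have "?p / (?q * Upsilon lam k r) = 1 / Upsilon lam k s"
      using Upsilon_shift[OF assms(1) r(2,3)] nz by (simp add: field_simps)
    moreover have "1 / ((- 2) powi (int r - int k) * (- 2) powi (int s - int r)) = (- 2 :: complex) powi (int k - int s)"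
      by (simp add: power_int_diff field_simps)
    moreover have "coeff_double g x lam k r * coeff_half g x ?mu r s =
        1 / ((- 2) powi (int r - int k) * (- 2) powi (int s - int r)) * (?p / (?q * Upsilon lam k r)) *
         (G (- b) $ (2 * k - r) * G b $ (r - 2 * s))"
      unfolding half coeff_double_eq b_def by (simp add: mult_ac)
    ultimately show "coeff_double g x lam k r * coeff_half g x ?mu r s =
         (- 2) powi (int k - int s) / Upsilon lam k s * (G (- b) $ (2 * k - r) * G b $ (r - 2 * s))"
      by simp
  qed
  also have "\<dots> = (- 2) powi (int k - int s) / Upsilon lam k s *
      (\<Sum>r = 2 * s..2 * k. G (- b) $ (2 * k - r) * G b $ (r - 2 * s))"
    by (simp add: sum_distrib_left)
  also have "(\<Sum>r = 2 * s..2 * k. G (- b) $ (2 * k - r) * G b $ (r - 2 * s)) = (G b * G (- b)) $ (2 * k - 2 * s)"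
    unfolding fps_mult_nth
    by (rule sum.reindex_bij_witness[of _ "\<lambda>i. i + 2 * s" "\<lambda>r. r - 2 * s"]) (use assms(2) in \<open>auto simp: mult_ac\<close>)
  also have "\<dots> = (if s = k then 1 else 0)"
    unfolding G_mult_G_minus using assms(2) by auto
  finally show ?thesis
    using Upsilon_diagonal[OF assms(1)] by auto
qed

end

section \<open>Exceptional parameters\<close>

lemma identity_in_parameterI:
  assumes "\<And>lam. lam \<notin> S \<Longrightarrow> L lam = R lam" "\<And>lam. isCont L lam" "\<And>z. \<not> z islimpt S"
  shows "identity_in_parameter S L R"
  unfolding identity_in_parameter_def
proof (intro conjI allI impI)
  fix lam :: complex
  have "eventually (\<lambda>z. z \<notin> S) (at lam)"
    using assms(3)[of lam] by (simp add: islimpt_iff_eventually)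
  hence "eventually (\<lambda>z. L z = R z) (at lam)"
    by eventually_elim (use assms(1) in auto)
  moreover have "(L \<longlongrightarrow> L lam) (at lam)"
    using assms(2)[of lam] by (simp add: isCont_def)
  ultimately show "(R \<longlongrightarrow> L lam) (at lam)"
    by (rule Lim_transform_eventually[rotated])
qed (use assms(1) in auto)

lemma not_islimpt_sing_half: "\<not> z islimpt sing_half k"
proof -
  have "sing_half k \<subseteq> (\<lambda>j. (- of_nat j - of_nat k) / 2) ` {..<k}"
    by (auto simp: sing_half_def pochhammer_eq_0_iff image_iff field_simps)
  hence "finite (sing_half k)" by (rule finite_subset) auto
  thus ?thesis by (rule islimpt_finite)
qed

lemma not_islimpt_sing_double: "\<not> z islimpt sing_double k"
proof (rule discrete_imp_not_islimpt[of "1 / 2"])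
  have int: "2 * u \<in> \<int>" if "u \<in> sing_double k" for u
  proof -
    from that consider "u \<in> \<int>" | "2 * u + 2 * of_nat k \<in> \<int>"
      by (auto simp: sing_double_def dest: nonpos_Ints_Int)
    thus ?thesis
    proof cases
      case 2
      hence "2 * u + 2 * of_nat k - 2 * of_nat k \<in> \<int>"
        by (intro Ints_diff Ints_mult) auto
      thus ?thesis by simp
    qed auto
  qed
  \<comment> \<open>distinct half-integers have distance at least \<open>1 / 2\<close>\<close>
  fix u v assume uv: "u \<in> sing_double k" "v \<in> sing_double k" "dist v u < 1 / 2"
  then obtain m n where mn: "2 * u = of_int m" "2 * v = of_int n"
    using int by (meson Ints_cases)
  have "cmod (2 * v - 2 * u) = 2 * dist v u"
    unfolding right_diff_distrib[symmetric] norm_mult dist_norm by simp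
  hence "cmod (of_int (n - m)) < 1"
    using uv(3) unfolding mn by simp
  hence "n = m" by (simp only: norm_of_int)
  hence "2 * v = 2 * u" unfolding mn by simp
  thus "v = u" by simp
qed simp

lemma isCont_gegenbauer: "isCont (\<lambda>lam. gegenbauer k (f lam) X) lam" if "isCont f lam"
  unfolding gegenbauer_def by (intro continuous_intros isCont_o2[OF that isCont_pochhammer]) auto

section \<open>The arguments $x$ and $1/x$\<close>

lemma one_minus_square_powr_half:
  fixes x :: real
  assumes "- 1 < x" "x < 1"
  shows "(1 - x\<^sup>2) powr (real n / 2) = sqrt (1 - x\<^sup>2) ^ n"
proof -
  have "1 - x\<^sup>2 > 0" using assms by (simp add: abs_square_less_1 abs_less_iff)
  thus ?thesis
    by (simp add: powr_half_sqrt[symmetric] powr_powr flip: powr_realpow)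
qed

lemma w_of_eq:
  assumes "- 1 < x" "x < 1"
  shows "w_of x = (1 - of_real x) / of_real (sqrt (1 - x\<^sup>2))"
    and "1 / w_of x = (1 + of_real x) / of_real (sqrt (1 - x\<^sup>2))"
    and "(1 / w_of x)\<^sup>2 = (1 + of_real x) / (1 - of_real x)"
proof -
  have pos: "1 - x > 0" "1 + x > 0" using assms by auto
  have sq: "1 - x\<^sup>2 = (1 - x) * (1 + x)" by (simp add: algebra_simps power2_eq_square)
  have "sqrt ((1 - x) / (1 + x)) = (1 - x) / sqrt (1 - x\<^sup>2)"
    unfolding sq real_sqrt_divide real_sqrt_mult using pos
    by (simp add: field_simps)
  hence "w_of x = of_real ((1 - x) / sqrt (1 - x\<^sup>2))"
    by (simp only: w_of_def)
  thus "w_of x = (1 - of_real x) / of_real (sqrt (1 - x\<^sup>2))"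
    by simp
  have "1 / sqrt ((1 - x) / (1 + x)) = (1 + x) / sqrt (1 - x\<^sup>2)"
    unfolding sq real_sqrt_divide real_sqrt_mult using pos
    by (simp add: field_simps)
  hence "of_real (1 / sqrt ((1 - x) / (1 + x))) = (of_real ((1 + x) / sqrt (1 - x\<^sup>2)) :: complex)"
    by (simp only:)
  thus "1 / w_of x = (1 + of_real x) / of_real (sqrt (1 - x\<^sup>2))"
    by (simp add: w_of_def)
  have "(1 / sqrt ((1 - x) / (1 + x)))\<^sup>2 = (1 + x) / (1 - x)"
    using pos by (simp add: power_divide)
  hence "of_real ((1 / sqrt ((1 - x) / (1 + x)))\<^sup>2) = (of_real ((1 + x) / (1 - x)) :: complex)"
    by (simp only:)
  thus "(1 / w_of x)\<^sup>2 = (1 + of_real x) / (1 - of_real x)"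
    by (simp add: w_of_def)
qed

text \<open>
  In terms of $u = z/\sqrt{1-x^2}$ the terms $wz$ and $z/w$ are $(1-x)u$ and $(1+x)u$, and in terms of
  $v = z/(1-x)$ the terms $z$ and $z/w^2$ are $(1-x)v$ and $(1+x)v$. Both factorisations
  become polynomial identities in this way.
\<close>
lemma gegenbauer_connection_gen_G:
  assumes "- 1 < x" "x < 1" "x \<noteq> 0"
  shows "gegenbauer_connection gen_G x (1 / of_real x) (of_real x / of_real (sqrt (1 - x\<^sup>2)))
           (of_real x) (1 / (1 - of_real x)) (w_of x) (1 / w_of x) 1"
proof
  fix n b
  show "gen_G n b b (w_of x) = fps_expansion (\<lambda>z. (1 - w_of x * z) powr b *
      (1 + 1 / w_of x * z) powr (- b) * (1 + 1 * z\<^sup>2) powr (- b)) 0 $ n"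
    by (simp add: gen_G_def)
next
  fix z :: complex
  define u where "u = z / of_real (sqrt (1 - x\<^sup>2))"
  have "1 / of_real x * (of_real x / of_real (sqrt (1 - x\<^sup>2))) * z = u"
       "(of_real x / of_real (sqrt (1 - x\<^sup>2)))\<^sup>2 * z\<^sup>2 = (of_real x * u)\<^sup>2"
    using assms(3) by (simp_all add: u_def power_mult_distrib power_divide)
  moreover have "w_of x * z = (1 - of_real x) * u"
    unfolding w_of_eq(1)[OF assms(1,2)] by (simp add: u_def)
  moreover have "1 / w_of x * z = (1 + of_real x) * u"
    unfolding w_of_eq(2)[OF assms(1,2)] by (simp add: u_def)
  ultimately show "(1 - 1 / of_real x * (of_real x / of_real (sqrt (1 - x\<^sup>2))) * z)\<^sup>2 -
      (of_real x / of_real (sqrt (1 - x\<^sup>2)))\<^sup>2 * z\<^sup>2 = (1 - w_of x * z) * (1 - 1 / w_of x * z)"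
    by (simp only:) (simp add: algebra_simps power2_eq_square)
next
  fix z :: complex
  define v where "v = z / (1 - of_real x)"
  have z: "z = (1 - of_real x) * v" using assms(2) by (simp add: v_def)
  have 1: "of_real x * (1 / (1 - of_real x)) * z = of_real x * v"
      "(1 / (1 - of_real x))\<^sup>2 * z\<^sup>2 = v\<^sup>2"
   and 2: "(1 / w_of x)\<^sup>2 * z = (1 + of_real x) * v"
    unfolding w_of_eq(3)[OF assms(1,2)] by (simp_all add: v_def power_divide)
  have "(1 - of_real x * v)\<^sup>2 - v\<^sup>2 = (1 - (1 + of_real x) * v) * (1 + 1 * ((1 - of_real x) * v))"
    by (simp add: algebra_simps power2_eq_square)
  thus "(1 - of_real x * (1 / (1 - of_real x)) * z)\<^sup>2 - (1 / (1 - of_real x))\<^sup>2 * z\<^sup>2 =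
      (1 - (1 / w_of x)\<^sup>2 * z) * (1 + 1 * z)"
    unfolding 1 2 unfolding z .
qed

text \<open>
  The same substitutions as for \<open>gen_G\<close>. Exchanging $x$ with $1/x$ changes the sign of $X^2 - 1$, and with it
  the signs of $w$ and of $z^2$ in the generating function.
\<close>
lemma gegenbauer_connection_gen_Ghat:
  assumes "- 1 < x" "x < 1" "x \<noteq> 0"
  shows "gegenbauer_connection gen_Ghat x (of_real x) (1 / of_real (sqrt (1 - x\<^sup>2)))
           (1 / of_real x) (of_real x / (1 - of_real x)) (- w_of x) (1 / w_of x) (- 1)"
proof
  fix n b
  show "gen_Ghat n b b (w_of x) = fps_expansion (\<lambda>z. (1 - (- w_of x) * z) powr b *
      (1 + 1 / w_of x * z) powr (- b) * (1 + (- 1) * z\<^sup>2) powr (- b)) 0 $ n"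
    by (simp add: gen_Ghat_def)
next
  fix z :: complex
  define u where "u = z / of_real (sqrt (1 - x\<^sup>2))"
  have "of_real x * (1 / of_real (sqrt (1 - x\<^sup>2))) * z = of_real x * u"
       "(1 / of_real (sqrt (1 - x\<^sup>2)))\<^sup>2 * z\<^sup>2 = u\<^sup>2"
    by (simp_all add: u_def power_divide)
  moreover have "- w_of x * z = - ((1 - of_real x) * u)"
    unfolding w_of_eq(1)[OF assms(1,2)] by (simp add: u_def)
  moreover have "1 / w_of x * z = (1 + of_real x) * u"
    unfolding w_of_eq(2)[OF assms(1,2)] by (simp add: u_def)
  ultimately show "(1 - of_real x * (1 / of_real (sqrt (1 - x\<^sup>2))) * z)\<^sup>2 -
      (1 / of_real (sqrt (1 - x\<^sup>2)))\<^sup>2 * z\<^sup>2 = (1 - (- w_of x) * z) * (1 - 1 / w_of x * z)"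
    by (simp only:) (simp add: algebra_simps power2_eq_square)
next
  fix z :: complex
  define v where "v = z / (1 - of_real x)"
  have z: "z = (1 - of_real x) * v" using assms(2) by (simp add: v_def)
  have 1: "1 / of_real x * (of_real x / (1 - of_real x)) * z = v"
      "(of_real x / (1 - of_real x))\<^sup>2 * z\<^sup>2 = (of_real x * v)\<^sup>2"
   and 2: "(1 / w_of x)\<^sup>2 * z = (1 + of_real x) * v"
    using assms(3) unfolding w_of_eq(3)[OF assms(1,2)] by (simp_all add: v_def power_divide power_mult_distrib)
  have "(1 - v)\<^sup>2 - (of_real x * v)\<^sup>2 = (1 - (1 + of_real x) * v) * (1 + (- 1) * ((1 - of_real x) * v))"
    by (simp add: algebra_simps power2_eq_square)
  thus "(1 - 1 / of_real x * (of_real x / (1 - of_real x)) * z)\<^sup>2 - (of_real x / (1 - of_real x))\<^sup>2 * z\<^sup>2 =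
      (1 - (1 / w_of x)\<^sup>2 * z) * (1 + (- 1) * z)"
    unfolding 1 2 unfolding z .
qed

theorem corollary14:
  fixes k :: nat and x :: real
  assumes "- 1 < x" and "x < 1" and "x \<noteq> 0"
  shows
    "identity_in_parameter (sing_half k)
       (\<lambda>lam. gegenbauer k lam (1 / of_real x) / (of_real ((1 - x\<^sup>2) powr (real k / 2)) * of_real x powi (- int k)))
       (\<lambda>lam. \<Sum>r\<le>k div 2. coeff_half gen_G x lam k r / (1 - of_real x) ^ r
                 * gegenbauer r (of_nat k - of_nat r + lam) (of_real x)) \<and>
     identity_in_parameter (sing_double k)
       (\<lambda>lam. gegenbauer k (of_nat k + lam) (of_real x) / (1 - of_real x) ^ k)
       (\<lambda>lam. \<Sum>r\<le>2 * k. coeff_double gen_G x lam k r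
                   / (of_real ((1 - x\<^sup>2) powr (real r / 2)) * of_real x powi (- int r))
                 * gegenbauer r (2 * of_nat k - of_nat r + lam) (1 / of_real x)) \<and>
     identity_in_parameter (sing_half k)
       (\<lambda>lam. gegenbauer k lam (of_real x) / of_real ((1 - x\<^sup>2) powr (real k / 2)))
       (\<lambda>lam. \<Sum>r\<le>k div 2. coeff_half gen_Ghat x lam k r
                   / ((1 - of_real x) ^ r * of_real x powi (- int r))
                 * gegenbauer r (of_nat k - of_nat r + lam) (1 / of_real x)) \<and>
     identity_in_parameter (sing_double k)
       (\<lambda>lam. gegenbauer k (of_nat k + lam) (1 / of_real x) / ((1 - of_real x) ^ k * of_real x powi (- int k)))
       (\<lambda>lam. \<Sum>r\<le>2 * k. coeff_double gen_Ghat x lam k r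
                   / of_real ((1 - x\<^sup>2) powr (real r / 2))
                 * gegenbauer r (2 * of_nat k - of_nat r + lam) (of_real x)) \<and>
     (\<forall>g \<in> {gen_G, gen_Ghat}. \<forall>lam. lam \<notin> sing_double k \<longrightarrow>
        (\<forall>s\<le>k. (\<Sum>r = 2 * s..2 * k. coeff_double g x lam k r
                     * coeff_half g x (lam + 2 * of_nat k - of_nat r) r s)
                  = (if s = k then 1 else 0)))"
proof -
  define s :: complex where "s = of_real (sqrt (1 - x\<^sup>2))"
  have s: "of_real ((1 - x\<^sup>2) powr (real n / 2)) = s ^ n" for n
    by (simp add: one_minus_square_powr_half[OF assms(1,2)] s_def)
  note scale = power_int_minus power_int_of_nat power_divide divide_inverse inverse_mult_distrib
    inverse_inverse_eq mult_1_left power_mult_distrib power_inverse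
  interpret G: gegenbauer_connection gen_G x "1 / of_real x" "of_real x / s"
      "of_real x" "1 / (1 - of_real x)" "w_of x" "1 / w_of x" 1
    unfolding s_def by (rule gegenbauer_connection_gen_G[OF assms])
  interpret Ghat: gegenbauer_connection gen_Ghat x "of_real x" "1 / s"
      "1 / of_real x" "of_real x / (1 - of_real x)" "- w_of x" "1 / w_of x" "- 1"
    unfolding s_def by (rule gegenbauer_connection_gen_Ghat[OF assms])
  note half = identity_in_parameterI[OF _ _ not_islimpt_sing_half]
  note double = identity_in_parameterI[OF _ _ not_islimpt_sing_double]
  note cont = isCont_gegenbauer isCont_mult continuous_const isCont_add continuous_ident
  show ?thesis
  proof (intro conjI)
    have "identity_in_parameter (sing_half k)
       (\<lambda>lam. (of_real x / s) ^ k * gegenbauer k lam (1 / of_real x))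
       (\<lambda>lam. \<Sum>r\<le>k div 2. coeff_half gen_G x lam k r * ((1 / (1 - of_real x)) ^ r
                 * gegenbauer r (of_nat k - of_nat r + lam) (of_real x)))"
      by (intro half G.half_expansion cont)
    thus "identity_in_parameter (sing_half k)
       (\<lambda>lam. gegenbauer k lam (1 / of_real x) / (of_real ((1 - x\<^sup>2) powr (real k / 2)) * of_real x powi (- int k)))
       (\<lambda>lam. \<Sum>r\<le>k div 2. coeff_half gen_G x lam k r / (1 - of_real x) ^ r
                 * gegenbauer r (of_nat k - of_nat r + lam) (of_real x))"
      unfolding s by (simp only: scale mult_ac)
  next
    have "identity_in_parameter (sing_double k)
       (\<lambda>lam. (1 / (1 - of_real x)) ^ k * gegenbauer k (of_nat k + lam) (of_real x))
       (\<lambda>lam. \<Sum>r\<le>2 * k. coeff_double gen_G x lam k r * ((of_real x / s) ^ r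
                 * gegenbauer r (2 * of_nat k - of_nat r + lam) (1 / of_real x)))"
      by (intro double G.double_expansion cont)
    thus "identity_in_parameter (sing_double k)
       (\<lambda>lam. gegenbauer k (of_nat k + lam) (of_real x) / (1 - of_real x) ^ k)
       (\<lambda>lam. \<Sum>r\<le>2 * k. coeff_double gen_G x lam k r
                   / (of_real ((1 - x\<^sup>2) powr (real r / 2)) * of_real x powi (- int r))
                 * gegenbauer r (2 * of_nat k - of_nat r + lam) (1 / of_real x))"
      unfolding s by (simp only: scale mult_ac)
  next
    have "identity_in_parameter (sing_half k)
       (\<lambda>lam. (1 / s) ^ k * gegenbauer k lam (of_real x))
       (\<lambda>lam. \<Sum>r\<le>k div 2. coeff_half gen_Ghat x lam k r * ((of_real x / (1 - of_real x)) ^ r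
                 * gegenbauer r (of_nat k - of_nat r + lam) (1 / of_real x)))"
      by (intro half Ghat.half_expansion cont)
    thus "identity_in_parameter (sing_half k)
       (\<lambda>lam. gegenbauer k lam (of_real x) / of_real ((1 - x\<^sup>2) powr (real k / 2)))
       (\<lambda>lam. \<Sum>r\<le>k div 2. coeff_half gen_Ghat x lam k r
                   / ((1 - of_real x) ^ r * of_real x powi (- int r))
                 * gegenbauer r (of_nat k - of_nat r + lam) (1 / of_real x))"
      unfolding s by (simp only: scale mult_ac)
  next
    have "identity_in_parameter (sing_double k)
       (\<lambda>lam. (of_real x / (1 - of_real x)) ^ k * gegenbauer k (of_nat k + lam) (1 / of_real x))
       (\<lambda>lam. \<Sum>r\<le>2 * k. coeff_double gen_Ghat x lam k r * ((1 / s) ^ r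
                 * gegenbauer r (2 * of_nat k - of_nat r + lam) (of_real x)))"
      by (intro double Ghat.double_expansion cont)
    thus "identity_in_parameter (sing_double k)
       (\<lambda>lam. gegenbauer k (of_nat k + lam) (1 / of_real x) / ((1 - of_real x) ^ k * of_real x powi (- int k)))
       (\<lambda>lam. \<Sum>r\<le>2 * k. coeff_double gen_Ghat x lam k r
                   / of_real ((1 - x\<^sup>2) powr (real r / 2))
                 * gegenbauer r (2 * of_nat k - of_nat r + lam) (of_real x))"
      unfolding s by (simp only: scale mult_ac)
  next
    show "\<forall>g \<in> {gen_G, gen_Ghat}. \<forall>lam. lam \<notin> sing_double k \<longrightarrow>
        (\<forall>s\<le>k. (\<Sum>r = 2 * s..2 * k. coeff_double g x lam k r
                     * coeff_half g x (lam + 2 * of_nat k - of_nat r) r s)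
                  = (if s = k then 1 else 0))"
      using G.coeff_double_coeff_half_inverse Ghat.coeff_double_coeff_half_inverse by blast
  qed
qed

end
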